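(* Let $k,n\ge1$ be integers, let $A\in\Lambda(k,n)$, let $1\le m\le n$ be an integer and let $p=m/n$. Then \[ \operatorname{Per}_m(A)\ \ge\ \frac{\big(\frac{k-p}{k}\big)^{n(k-p)}\cdot\big(1-\frac1n\big)^{2(1-\frac1n)\,n(n-m)}}{\big(\frac pk\big)^{m}\cdot n^{-2(n-m)}\cdot\big((n-m)!\big)^2}. \]
   Context: $\Lambda(k,n)$ is the set of $n\times n$ matrices with nonnegative integer entries all of whose row and column sums equal $k$. For an $n\times n$ matrix $A$ and $1\le m\le n$, $\operatorname{Per}_m(A)$ is the sum of the permanents of all $m\times m$ submatrices of $A$ (permanent $\operatorname{Per}(M)=\sum_{\sigma}\prod_i M_{i\sigma(i)}$). Convention: $0^0=1$. *)

theory Defs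
  imports "HOL-Analysis.Analysis"
begin

definition in_Lambda :: "nat \<Rightarrow> nat \<Rightarrow> (nat \<Rightarrow> nat \<Rightarrow> nat) \<Rightarrow> bool" where
  "in_Lambda k n A \<longleftrightarrow>
     (\<forall>i<n. (\<Sum>j<n. A i j) = k) \<and> (\<forall>j<n. (\<Sum>i<n. A i j) = k)"

definition per_sub :: "(nat \<Rightarrow> nat \<Rightarrow> nat) \<Rightarrow> nat set \<Rightarrow> nat set \<Rightarrow> nat" where
  "per_sub A I J = (\<Sum>\<sigma> \<in> {\<sigma> \<in> I \<rightarrow>\<^sub>E J. bij_betw \<sigma> I J}. \<Prod>i\<in>I. A i (\<sigma> i))"

definition Per_m :: "nat \<Rightarrow> nat \<Rightarrow> (nat \<Rightarrow> nat \<Rightarrow> nat) \<Rightarrow> nat" where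
  "Per_m n m A = (\<Sum>I \<in> {I. I \<subseteq> {0..<n} \<and> card I = m}.
                    \<Sum>J \<in> {J. J \<subseteq> {0..<n} \<and> card J = m}. per_sub A I J)"

text \<open>Real power with the convention 0^0 = 1 (x assumed nonnegative).\<close>
definition rpow :: "real \<Rightarrow> real \<Rightarrow> real" where
  "rpow x y = (if x = 0 then (if y = 0 then 1 else 0) else x powr y)"

end

theory Submission
  imports Defs "HOL-Computational_Algebra.Fundamental_Theorem_Algebra"
begin

text \<open>
  The proof is a variant of Gurvits' capacity method. Put \<open>d = n - m\<close> and start from the product over the
  rows \<open>i\<close> of the linear forms \<open>(\<Sum>j. A i j * x j) + (y 1 + \<dots> + y d) + z\<close>. Truncate it, one variable
  at a time, to degree at most 1 in every \<open>x j\<close> and every \<open>y l\<close>. The final polynomial only sees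
  injective assignments, and the part with \<open>z = 0\<close> of top degree \<open>d\<close> in the \<open>y l\<close> is \<open>d!\<close>
  times \<open>Per_m\<close> at \<open>x = y = 1\<close>.

  Truncation preserves the property of having no zeros in a (suitably closed) half-plane, so every
  restriction to one variable at a positive point has only negative real roots. If such a polynomial of
  degree at most \<open>N\<close> dominates \<open>K * t powr \<alpha>\<close>, then its truncation dominates
  \<open>cap_loss \<alpha> N * K * t powr \<alpha>\<close>. By AM-GM the initial product is at least
  \<open>(k / p) ^ m * n ^ d\<close> times the product of all \<open>x j powr p\<close> and all \<open>y l\<close>, and the \<open>x j\<close> occur
  with degree at most \<open>k\<close>, the \<open>y l\<close> with degree at most \<open>n\<close>. The resulting bound is stronger than the
  claim by the factor \<open>d! / (g ^ d * d ^ d) \<ge> 1\<close>, where \<open>g = (1 - 1 / n) ^ (n - 1)\<close>.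
\<close>

section \<open>Truncating polynomials in one variable\<close>

text \<open>Normalising each linear factor to constant term 1 makes the two lowest coefficients
  readable: their ratio is the sum of the \<open>\<rho> i\<close>, the negated reciprocals of the
  zeros.\<close>

lemma poly_factorization_at_0:
  fixes P :: "complex poly"
  assumes "poly P 0 \<noteq> 0"
  obtains \<rho> where "P = smult (poly P 0) (\<Prod>i<degree P. [:1, \<rho> i:])"
    and "\<And>i. i < degree P \<Longrightarrow> \<rho> i \<noteq> 0 \<and> poly P (- 1 / \<rho> i) = 0"
proof -
  obtain r where r: "smult (lead_coeff P) (\<Prod>i<degree P. [:- r i, 1:]) = P"
    using complex_poly_decompose'[of P] by blast
  have ev: "poly P x = lead_coeff P * (\<Prod>i<degree P. x - r i)" for x
    by (subst r[symmetric]) (simp add: poly_prod)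
  have r0: "r i \<noteq> 0" if "i < degree P" for i
  proof
    assume "r i = 0"
    hence "(\<Prod>i<degree P. 0 - r i) = 0" using that by auto
    with ev[of 0] assms show False by (metis mult_zero_right)
  qed
  have root: "poly P (r i) = 0" if "i < degree P" for i
    using that by (auto simp: ev)
  have "poly P x = poly (smult (poly P 0) (\<Prod>i<degree P. [:1, - 1 / r i:])) x" for x
  proof -
    have "poly (smult (poly P 0) (\<Prod>i<degree P. [:1, - 1 / r i:])) x
        = lead_coeff P * ((\<Prod>i<degree P. - r i) * (\<Prod>i<degree P. 1 - x / r i))"
      by (simp only: ev[of 0] poly_prod poly_smult mult.assoc) simp
    also have "(\<Prod>i<degree P. - r i) * (\<Prod>i<degree P. 1 - x / r i) = (\<Prod>i<degree P. x - r i)"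
      unfolding prod.distrib[symmetric] using r0 by (intro prod.cong) (auto simp: field_simps)
    finally show ?thesis by (simp only: ev)
  qed
  hence "P = smult (poly P 0) (\<Prod>i<degree P. [:1, - 1 / r i:])"
    by (intro poly_ext) blast
  thus thesis using r0 root by (intro that[of "\<lambda>i. - 1 / r i"]) auto
qed

lemma coeff_1_prod_linear:
  fixes \<rho> :: "'i \<Rightarrow> 'a::comm_ring_1"
  assumes "finite A"
  shows "coeff (\<Prod>i\<in>A. [:1, \<rho> i:]) 0 = 1" "coeff (\<Prod>i\<in>A. [:1, \<rho> i:]) 1 = (\<Sum>i\<in>A. \<rho> i)"
  using assms by (induction A rule: finite_induct) (auto simp: coeff_pCons split: nat.splits)

text \<open>All zeros \<open>- 1 / \<rho> i\<close> satisfy Re (u s) < 0, which is the same as Re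
  (\<rho> i / u) > 0. This condition is additive, so it passes to the sum \<open>R\<close>, and the
  zero \<open>- 1 / R\<close> of the truncation lies in the same open half-plane.\<close>

lemma truncation_stable:
  fixes P :: "complex poly" and u t :: complex
  assumes nz: "\<And>s. Re (u * s) \<ge> 0 \<Longrightarrow> poly P s \<noteq> 0" and t: "Re (u * t) \<ge> 0"
  shows "coeff P 0 + coeff P 1 * t \<noteq> 0"
proof
  assume eq: "coeff P 0 + coeff P 1 * t = 0"
  have P0: "poly P 0 \<noteq> 0" using nz[of 0] by simp
  obtain \<rho> where fac: "P = smult (poly P 0) (\<Prod>i<degree P. [:1, \<rho> i:])"
    and rho: "\<And>i. i < degree P \<Longrightarrow> \<rho> i \<noteq> 0 \<and> poly P (- 1 / \<rho> i) = 0"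
    using poly_factorization_at_0[OF P0] by blast
  define R where "R = (\<Sum>i<degree P. \<rho> i)"
  have c1: "coeff P 1 = poly P 0 * R"
    by (subst fac) (simp add: coeff_1_prod_linear[unfolded One_nat_def] R_def)
  have "poly P 0 * (1 + R * t) = 0" using eq c1 by (simp add: poly_0_coeff_0 algebra_simps)
  hence Rt: "R * t = - 1" using P0 by (simp add: add_eq_0_iff)
  have t0: "t \<noteq> 0" using Rt by auto
  \<comment> \<open>For \<open>u = 0\<close> the hypothesis excludes all zeros, so \<open>P\<close>
    is constant and \<open>R\<close> is an empty sum.\<close>
  have u0: "u \<noteq> 0"
  proof
    assume "u = 0"
    hence "poly P s \<noteq> 0" for s using nz by simp
    hence "degree P = 0" using rho by (metis gr0I)
    thus False using Rt by (simp add: R_def)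
  qed
  have pos: "Re (\<rho> i / u) > 0" if "i < degree P" for i
  proof -
    have "Re (u * (- 1 / \<rho> i)) < 0" using nz[of "- 1 / \<rho> i"] rho[OF that] by (meson not_le)
    hence "Re (u / \<rho> i) > 0" by simp
    hence "Re (inverse (u / \<rho> i)) > 0"
      unfolding inverse_complex.sel
      by (intro divide_pos_pos add_pos_nonneg zero_less_power zero_le_power2)
    thus ?thesis by simp
  qed
  have "R / u = - inverse (u * t)" using Rt t0 u0 by (simp add: field_simps)
  moreover have "Re (inverse (u * t)) \<ge> 0"
    unfolding inverse_complex.sel using t by (intro divide_nonneg_nonneg) auto
  ultimately have "Re (R / u) \<le> 0" by simp
  moreover have "Re (R / u) = (\<Sum>i<degree P. Re (\<rho> i / u))"
    by (simp add: R_def sum_divide_distrib)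
  moreover have "degree P > 0" using Rt by (cases "degree P") (auto simp: R_def)
  hence "(\<Sum>i<degree P. Re (\<rho> i / u)) > 0" using pos by (intro sum_pos) auto
  ultimately show False by simp
qed

text \<open>AM-GM for \<open>N\<close> factors, the last \<open>N - d\<close> of them equal to 1.
  With \<open>a\<close> their mean, x / a \<le> exp (x / a - 1) holds for each factor, and the
  exponents add up to 0.\<close>

lemma prod_le_mean_power:
  fixes \<rho> :: "nat \<Rightarrow> real"
  assumes "\<And>i. i < d \<Longrightarrow> \<rho> i \<ge> 0" "d \<le> N" "N \<ge> 1" "t \<ge> 0"
  shows "(\<Prod>i<d. 1 + \<rho> i * t) \<le> (1 + (\<Sum>i<d. \<rho> i) * t / real N) ^ N"
proof -
  define a where "a = 1 + (\<Sum>i<d. \<rho> i) * t / real N"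
  have a: "a \<ge> 1" unfolding a_def using assms by (auto intro!: divide_nonneg_nonneg mult_nonneg_nonneg sum_nonneg)
  have le: "x / a \<le> exp (x / a - 1)" for x using exp_ge_add_one_self[of "x / a - 1"] by simp
  have "(\<Prod>i<d. (1 + \<rho> i * t) / a) * (\<Prod>i\<in>{d..<N}. 1 / a)
      \<le> (\<Prod>i<d. exp ((1 + \<rho> i * t) / a - 1)) * (\<Prod>i\<in>{d..<N}. exp (1 / a - 1))"
    using a assms by (intro mult_mono prod_mono conjI le prod_nonneg) auto
  also have "\<dots> = exp ((\<Sum>i<d. (1 + \<rho> i * t) / a - 1) + (\<Sum>i\<in>{d..<N}. 1 / a - 1))"
    by (simp only: exp_add exp_sum finite_lessThan finite_atLeastLessThan)
  also have "(\<Sum>i<d. (1 + \<rho> i * t) / a - 1) + (\<Sum>i\<in>{d..<N}. 1 / a - 1)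
      = (real d + (\<Sum>i<d. \<rho> i) * t) / a - real d + (real N - real d) * (1 / a - 1)"
    using assms(2) by (simp add: sum_subtractf sum_divide_distrib[symmetric] sum.distrib
        sum_distrib_right of_nat_diff)
  also have "\<dots> = (real N + (\<Sum>i<d. \<rho> i) * t) / a - real N"
    using a by (simp add: field_simps)
  also have "real N + (\<Sum>i<d. \<rho> i) * t = real N * a" using assms by (simp add: a_def field_simps)
  also have "exp (real N * a / a - real N) = 1" using a by simp
  finally have "(\<Prod>i<d. 1 + \<rho> i * t) / a ^ d / a ^ (N - d) \<le> 1"
    by (simp add: prod_dividef power_divide divide_simps)
  hence "(\<Prod>i<d. 1 + \<rho> i * t) \<le> a ^ d * a ^ (N - d)" using a by (simp add: field_simps)
  thus ?thesis using assms(2) by (simp add: power_add[symmetric] a_def)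
qed

text \<open>Nonpositive real roots make all \<open>\<rho> i\<close> nonnegative reals, so the mean
  inequality applies. The two lowest coefficients thus control the growth of \<open>P\<close> on the
  positive axis.\<close>

lemma real_rooted_poly_le:
  fixes P :: "real poly"
  assumes "poly P 0 > 0" "degree P \<le> N" "N \<ge> 1"
    and roots: "\<And>z. poly (map_poly complex_of_real P) z = 0 \<Longrightarrow> Im z = 0 \<and> Re z \<le> 0"
  shows "coeff P 1 \<ge> 0"
    and "t \<ge> 0 \<Longrightarrow> poly P t \<le> poly P 0 * (1 + coeff P 1 / poly P 0 * t / real N) ^ N"
proof -
  define Q where "Q = map_poly complex_of_real P"
  have evQ: "poly Q (of_real x) = of_real (poly P x)" for x
    unfolding Q_def by (induction P) (simp_all add: map_poly_pCons)
  have degQ: "degree Q = degree P" unfolding Q_def by (simp add: degree_map_poly)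
  have Q0: "poly Q 0 = of_real (poly P 0)" using evQ[of 0] by simp
  obtain \<sigma> where fac: "Q = smult (poly Q 0) (\<Prod>i<degree Q. [:1, \<sigma> i:])"
    and sig: "\<And>i. i < degree Q \<Longrightarrow> \<sigma> i \<noteq> 0 \<and> poly Q (- 1 / \<sigma> i) = 0"
    using poly_factorization_at_0[of Q] Q0 assms(1) by auto
  define \<rho> where "\<rho> i = Re (\<sigma> i)" for i
  have sr: "\<sigma> i = of_real (\<rho> i)" "\<rho> i \<ge> 0" if "i < degree Q" for i
  proof -
    define z where "z = - 1 / \<sigma> i"
    have "Im z = 0 \<and> Re z \<le> 0" using roots[of z] sig[OF that] by (auto simp only: Q_def z_def)
    hence z: "z = of_real (Re z)" "Re z \<le> 0" by (auto simp: complex_eq_iff)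
    have "\<sigma> i = - 1 / z" using sig[OF that] by (simp add: z_def)
    hence s: "\<sigma> i = of_real (- 1 / Re z)" using z(1) by (metis of_real_divide of_real_minus of_real_1)
    thus "\<sigma> i = of_real (\<rho> i)" by (simp add: \<rho>_def)
    show "\<rho> i \<ge> 0" using s z(2) by (simp add: \<rho>_def)
  qed
  have "coeff Q 1 = poly Q 0 * (\<Sum>i<degree Q. \<sigma> i)"
    by (subst fac) (simp add: coeff_1_prod_linear[unfolded One_nat_def])
  also have "\<dots> = of_real (poly P 0 * (\<Sum>i<degree Q. \<rho> i))" by (simp add: Q0 sr(1))
  finally have c1: "coeff P 1 = poly P 0 * (\<Sum>i<degree Q. \<rho> i)"
    by (simp add: Q_def coeff_map_poly del: of_real_mult)
  show "coeff P 1 \<ge> 0" unfolding c1 using assms(1) sr(2)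
    by (intro mult_nonneg_nonneg sum_nonneg) auto
  assume t: "t \<ge> 0"
  have "complex_of_real (poly P t) = poly Q 0 * (\<Prod>i<degree Q. 1 + of_real t * \<sigma> i)"
    unfolding evQ[symmetric] by (subst fac) (simp add: poly_prod)
  also have "\<dots> = of_real (poly P 0 * (\<Prod>i<degree Q. 1 + \<rho> i * t))"
    by (simp add: Q0 sr(1) mult.commute)
  finally have "poly P t = poly P 0 * (\<Prod>i<degree Q. 1 + \<rho> i * t)"
    by (simp only: of_real_eq_iff)
  also have "\<dots> \<le> poly P 0 * (1 + (\<Sum>i<degree Q. \<rho> i) * t / real N) ^ N"
    using assms t sr(2) by (intro mult_left_mono prod_le_mean_power) (auto simp: degQ)
  finally show "poly P t \<le> poly P 0 * (1 + coeff P 1 / poly P 0 * t / real N) ^ N"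
    unfolding c1 using assms(1) by simp
qed

section \<open>Powers with 0^0 = 1 and the capacity lost by one truncation\<close>

lemma rpow_eq_powr: "x > 0 \<Longrightarrow> rpow x y = x powr y"
  by (simp add: rpow_def)

lemma rpow_nonneg: "rpow x y \<ge> 0"
  by (simp add: rpow_def)

lemma rpow_self_pos: "x \<ge> 0 \<Longrightarrow> rpow x x > 0"
  by (simp add: rpow_def)

lemma rpow_of_nat: "x \<ge> 0 \<Longrightarrow> rpow x (real j) = x ^ j"
  by (simp add: rpow_def powr_realpow)

lemma rpow_power:
  assumes "x \<ge> 0" "j \<ge> 1"
  shows "rpow x y ^ j = rpow x (real j * y)"
  using assms by (auto simp: rpow_def powr_power powr_realpow[symmetric] powr_powr mult.commute)

text \<open>The loss arises from bounding a real-rooted polynomial by \<open>c * (1 + R * t / N) ^ N\<close>, optimising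
  over \<open>t\<close>, and comparing with the minimum of \<open>(1 + X) / X powr \<alpha>\<close>.\<close>

definition cap_loss :: "real \<Rightarrow> nat \<Rightarrow> real" where
  "cap_loss \<alpha> N = rpow ((real N - \<alpha>) / real N) (real N - \<alpha>) / rpow (1 - \<alpha>) (1 - \<alpha>)"

lemma cap_loss_pos: "\<alpha> \<le> 1 \<Longrightarrow> N \<ge> 1 \<Longrightarrow> cap_loss \<alpha> N > 0"
  unfolding cap_loss_def using rpow_self_pos[of "1 - \<alpha>"]
  by (intro divide_pos_pos) (auto simp: rpow_def)

text \<open>Weighted AM-GM for \<open>X / \<alpha>\<close> and \<open>1 / (1 - \<alpha>)\<close>
  with weights \<open>\<alpha>\<close> and \<open>1 - \<alpha>\<close>, proved through ln y \<le> y
  - 1. The convention 0^0 = 1 covers the endpoint \<open>\<alpha> = 1\<close>.\<close>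

lemma one_plus_ge_powr:
  assumes "0 < \<alpha>" "\<alpha> \<le> 1" "X > 0"
  shows "1 + X \<ge> X powr \<alpha> / (\<alpha> powr \<alpha> * rpow (1 - \<alpha>) (1 - \<alpha>))"
proof (cases "\<alpha> = 1")
  case True
  thus ?thesis using assms by (simp add: rpow_def)
next
  case False
  hence a: "\<alpha> < 1" using assms by simp
  define s where "s = 1 + X"
  have s: "s > 0" using assms by (simp add: s_def)
  have "\<alpha> * ln (X / \<alpha> / s) + (1 - \<alpha>) * ln (1 / (1 - \<alpha>) / s)
      \<le> \<alpha> * (X / \<alpha> / s - 1) + (1 - \<alpha>) * (1 / (1 - \<alpha>) / s - 1)"
    using assms a s by (intro add_mono mult_left_mono ln_le_minus_one) auto
  also have "\<dots> = (X + 1) / s - 1" using assms a s by (simp add: field_simps)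
  also have "\<dots> = 0" using s by (simp add: s_def)
  finally have "\<alpha> * ln X - \<alpha> * ln \<alpha> - (1 - \<alpha>) * ln (1 - \<alpha>) \<le> ln s"
  proof -
    have "ln (X / \<alpha> / s) = ln X - ln \<alpha> - ln s" "ln (1 / (1 - \<alpha>) / s) = - ln (1 - \<alpha>) - ln s"
      using assms a s by (simp_all add: ln_div ln_mult)
    moreover assume "\<alpha> * ln (X / \<alpha> / s) + (1 - \<alpha>) * ln (1 / (1 - \<alpha>) / s) \<le> 0"
    ultimately have "\<alpha> * (ln X - ln \<alpha> - ln s) + (1 - \<alpha>) * (- ln (1 - \<alpha>) - ln s) \<le> 0"
      by (simp only:)
    thus ?thesis by (simp add: algebra_simps)
  qed
  hence "exp (\<alpha> * ln X - \<alpha> * ln \<alpha> - (1 - \<alpha>) * ln (1 - \<alpha>)) \<le> s"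
    using s by (metis exp_le_cancel_iff exp_ln)
  thus ?thesis using assms a
    by (simp add: rpow_eq_powr powr_def exp_diff s_def)
qed

lemma truncation_capacity:
  fixes P :: "real poly"
  assumes c0: "poly P 0 > 0" and "degree P \<le> N" "N \<ge> 1"
    and roots: "\<And>z. poly (map_poly complex_of_real P) z = 0 \<Longrightarrow> Im z = 0 \<and> Re z \<le> 0"
    and \<alpha>: "0 < \<alpha>" "\<alpha> \<le> 1" and K: "K > 0"
    and cap: "\<And>t. t > 0 \<Longrightarrow> poly P t \<ge> K * t powr \<alpha>"
    and s: "s > 0"
  shows "coeff P 0 + coeff P 1 * s \<ge> cap_loss \<alpha> N * K * s powr \<alpha>"
proof -
  define c where "c = poly P 0"
  define R where "R = coeff P 1 / c"
  have c: "c > 0" using c0 c_def by simp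
  have R0: "R \<ge> 0" using real_rooted_poly_le(1)[OF assms(1-4)] c by (simp add: R_def)
  have le: "K * t powr \<alpha> \<le> c * (1 + R * t / real N) ^ N" if "t > 0" for t
    using real_rooted_poly_le(2)[OF assms(1-4), of t] cap[OF that] that by (simp add: R_def c_def)
  have R: "R > 0"
  proof (rule ccontr)
    assume "\<not> R > 0"
    hence "R = 0" using R0 by simp
    \<comment> \<open>At this point the lower bound equals 2c, while a vanishing \<open>R\<close>
      leaves only c on the right.\<close>
    with le[of "(2 * c / K) powr (1 / \<alpha>)"] c K \<alpha> show False by (simp add: powr_powr)
  qed
  have tr: "coeff P 0 + coeff P 1 * s = c * (1 + R * s)"
    using c by (simp add: c_def R_def poly_0_coeff_0 field_simps)
  show ?thesis
  proof (cases "\<alpha> < real N")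
    \<comment> \<open>Both \<open>\<alpha>\<close> and \<open>N\<close> are 1 here, and the loss
      factor is 1.\<close>
    case False
    hence N: "N = 1" and a1: "\<alpha> = 1" using \<alpha> \<open>N \<ge> 1\<close> by linarith+
    have "K * s powr \<alpha> \<le> c * (1 + R * s)" using le[OF s] N by simp
    thus ?thesis unfolding tr by (simp add: N a1 cap_loss_def rpow_def)
  next
    case True
    define M where "M = real N"
    have M: "M > 0" "\<alpha> < M" using True \<open>N \<ge> 1\<close> by (auto simp: M_def)
    \<comment> \<open>The minimiser of (1 + R t / M)^M / t^\<alpha>, found by setting the
      logarithmic derivative to 0.\<close>
    define t where "t = \<alpha> * (M / (M - \<alpha>)) / R"
    have t: "t > 0" using \<alpha> M R by (simp add: t_def)
    have rt: "1 + R * t / M = M / (M - \<alpha>)"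
      using \<alpha> M R by (simp add: t_def field_simps)
    have "K * t powr \<alpha> \<le> c * (M / (M - \<alpha>)) powr M"
      using le[OF t] M \<open>N \<ge> 1\<close> unfolding rt[unfolded M_def]
      by (simp add: M_def powr_realpow)
    moreover have "(\<alpha> * (M / (M - \<alpha>)) / R) powr \<alpha> = \<alpha> powr \<alpha> * (M / (M - \<alpha>)) powr \<alpha> * R powr (- \<alpha>)"
      using \<alpha> M R by (simp only: powr_mult powr_divide powr_minus divide_inverse inverse_powr)
    ultimately have "K * (\<alpha> powr \<alpha> * (M / (M - \<alpha>)) powr \<alpha> * R powr (- \<alpha>))
        * (R powr \<alpha> * (M / (M - \<alpha>)) powr (- M))
      \<le> c * (M / (M - \<alpha>)) powr M * (R powr \<alpha> * (M / (M - \<alpha>)) powr (- M))"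
      unfolding t_def by (intro mult_right_mono) auto
    also have "\<dots> = c * R powr \<alpha>" using M \<alpha> by (simp add: powr_minus)
    also have "K * (\<alpha> powr \<alpha> * (M / (M - \<alpha>)) powr \<alpha> * R powr (- \<alpha>))
        * (R powr \<alpha> * (M / (M - \<alpha>)) powr (- M))
      = K * \<alpha> powr \<alpha> * ((M / (M - \<alpha>)) powr \<alpha> * (M / (M - \<alpha>)) powr (- M)) * (R powr (- \<alpha>) * R powr \<alpha>)"
      by simp
    also have "(M / (M - \<alpha>)) powr \<alpha> * (M / (M - \<alpha>)) powr (- M) = ((M - \<alpha>) / M) powr (M - \<alpha>)"
      using M \<alpha> by (simp add: powr_add[symmetric] powr_divide powr_diff powr_minus field_simps)
    also have "R powr (- \<alpha>) * R powr \<alpha> = 1" using R by (simp add: powr_minus)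
    finally have main: "K * \<alpha> powr \<alpha> * ((M - \<alpha>) / M) powr (M - \<alpha>) \<le> c * R powr \<alpha>" by simp
    define h where "h = rpow (1 - \<alpha>) (1 - \<alpha>)"
    have h: "h > 0" using rpow_self_pos[of "1 - \<alpha>"] \<alpha> by (simp add: h_def)
    have "cap_loss \<alpha> N * K * s powr \<alpha>
        = (K * \<alpha> powr \<alpha> * ((M - \<alpha>) / M) powr (M - \<alpha>)) * (s powr \<alpha> / (\<alpha> powr \<alpha> * h))"
      using M \<alpha> h by (simp add: cap_loss_def h_def[symmetric] M_def[symmetric] rpow_eq_powr)
    also have "\<dots> \<le> (c * R powr \<alpha>) * (s powr \<alpha> / (\<alpha> powr \<alpha> * h))"
      using main h by (intro mult_right_mono) auto
    also have "\<dots> = c * ((R * s) powr \<alpha> / (\<alpha> powr \<alpha> * h))" using R s by (simp add: powr_mult)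
    also have "\<dots> \<le> c * (1 + R * s)"
      unfolding h_def using \<alpha> R s c by (intro mult_left_mono one_plus_ge_powr) auto
    finally show ?thesis unfolding tr .
  qed
qed

section \<open>Truncated products of linear forms\<close>

text \<open>Expanding a product of linear forms picks one column per row. The number of rows sent to
  \<open>j\<close> is the degree of the resulting monomial in the variable \<open>j\<close>.\<close>

definition assignments :: "'r set \<Rightarrow> 'c set \<Rightarrow> 'c set \<Rightarrow> ('r \<Rightarrow> 'c) set" where
  "assignments R C S = {\<phi> \<in> R \<rightarrow>\<^sub>E C. \<forall>j\<in>S. card {i \<in> R. \<phi> i = j} \<le> 1}"

text \<open>This is the product of the linear forms \<open>\<Sum>j\<in>C. w i j * x j\<close> over \<open>i \<in> R\<close>, with all monomials
  deleted that have degree at least 2 in some variable of \<open>S\<close>.\<close>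

definition trunc_prod ::
  "'r set \<Rightarrow> 'c set \<Rightarrow> ('r \<Rightarrow> 'c \<Rightarrow> real) \<Rightarrow> 'c set \<Rightarrow> ('c \<Rightarrow> 'a) \<Rightarrow> 'a::real_normed_field" where
  "trunc_prod R C w S x = (\<Sum>\<phi>\<in>assignments R C S. \<Prod>i\<in>R. of_real (w i (\<phi> i)) * x (\<phi> i))"

text \<open>The field is generic so that growth can be studied over the reals and zeros over the
  complex numbers.\<close>

definition trunc_prod_poly ::
  "'r set \<Rightarrow> 'c set \<Rightarrow> ('r \<Rightarrow> 'c \<Rightarrow> real) \<Rightarrow> 'c set \<Rightarrow> 'c \<Rightarrow> ('c \<Rightarrow> 'a) \<Rightarrow> 'a::real_normed_field poly" where
  "trunc_prod_poly R C w S j x = (\<Sum>\<phi>\<in>assignments R C S.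
     monom (\<Prod>i\<in>R. of_real (w i (\<phi> i)) * (if \<phi> i = j then 1 else x (\<phi> i))) (card {i \<in> R. \<phi> i = j}))"

section \<open>Truncated products as polynomials in one variable\<close>

lemma finite_assignments: "finite R \<Longrightarrow> finite C \<Longrightarrow> finite (assignments R C S)"
  unfolding assignments_def by (rule finite_subset[of _ "R \<rightarrow>\<^sub>E C"]) (auto intro: finite_PiE)

lemma prod_fun_upd_eq:
  fixes x :: "'c \<Rightarrow> 'a::real_normed_field"
  assumes "finite R"
  shows "(\<Prod>i\<in>R. of_real (w i (\<phi> i)) * (x(j := t)) (\<phi> i))
    = (\<Prod>i\<in>R. of_real (w i (\<phi> i)) * (if \<phi> i = j then 1 else x (\<phi> i))) * t ^ card {i \<in> R. \<phi> i = j}"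
proof -
  have "t ^ card {i \<in> R. \<phi> i = j} = (\<Prod>i\<in>R. if \<phi> i = j then t else 1)"
    using assms by (simp add: prod.inter_filter[symmetric])
  thus ?thesis
    by (simp only: prod.distrib[symmetric]) (auto intro!: prod.cong)
qed

lemma poly_trunc_prod_poly:
  assumes "finite R"
  shows "poly (trunc_prod_poly R C w S j x) t = trunc_prod R C w S (x(j := t))"
  unfolding trunc_prod_poly_def trunc_prod_def
  by (simp only: poly_sum poly_monom prod_fun_upd_eq[OF assms])

text \<open>The link between the combinatorial and the analytic truncation: requiring
  \<open>j\<close> to be hit at most once keeps exactly the coefficients of degree 0 and 1 in that
  variable.\<close>

lemma trunc_prod_insert:
  assumes "finite R" "finite C"
  shows "trunc_prod R C w (insert j S) (x(j := t))
    = coeff (trunc_prod_poly R C w S j x) 0 + coeff (trunc_prod_poly R C w S j x) 1 * t"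
proof -
  let ?a = "\<lambda>\<phi>. \<Prod>i\<in>R. of_real (w i (\<phi> i)) * (if \<phi> i = j then 1 else x (\<phi> i))"
  let ?c = "\<lambda>\<phi>. card {i \<in> R. \<phi> i = j}"
  have eq: "assignments R C (insert j S) = {\<phi> \<in> assignments R C S. ?c \<phi> \<le> 1}"
    by (auto simp: assignments_def)
  have "trunc_prod R C w (insert j S) (x(j := t))
      = (\<Sum>\<phi>\<in>assignments R C S. if ?c \<phi> \<le> 1 then ?a \<phi> * t ^ ?c \<phi> else 0)"
    unfolding trunc_prod_def eq prod_fun_upd_eq[OF assms(1)]
    using finite_assignments[OF assms] by (simp add: sum.inter_filter)
  also have "\<dots> = (\<Sum>\<phi>\<in>assignments R C S. coeff (monom (?a \<phi>) (?c \<phi>)) 0 + coeff (monom (?a \<phi>) (?c \<phi>)) 1 * t)"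
  proof (intro sum.cong refl)
    fix \<phi>
    consider "?c \<phi> = 0" | "?c \<phi> = 1" | "?c \<phi> > 1" by linarith
    thus "(if ?c \<phi> \<le> 1 then ?a \<phi> * t ^ ?c \<phi> else 0)
        = coeff (monom (?a \<phi>) (?c \<phi>)) 0 + coeff (monom (?a \<phi>) (?c \<phi>)) 1 * t"
    proof cases
      case 3
      thus ?thesis by (simp only: coeff_monom) simp
    qed (simp_all only: coeff_monom, simp_all)
  qed
  also have "\<dots> = coeff (trunc_prod_poly R C w S j x) 0 + coeff (trunc_prod_poly R C w S j x) 1 * t"
    unfolding trunc_prod_poly_def by (simp only: coeff_sum sum.distrib sum_distrib_right)
  finally show ?thesis .
qed

text \<open>A monomial of higher degree in \<open>j\<close> must use a row whose weight at
  \<open>j\<close> is 0, so its coefficient vanishes.\<close>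

lemma degree_trunc_prod_poly_le:
  assumes "finite R" "card {i \<in> R. w i j \<noteq> 0} \<le> N"
  shows "degree (trunc_prod_poly R C w S j x) \<le> N"
  unfolding trunc_prod_poly_def
proof (intro degree_le allI impI)
  fix m assume m: "N < m"
  have "coeff (monom (\<Prod>i\<in>R. of_real (w i (\<phi> i)) * (if \<phi> i = j then 1 else x (\<phi> i)))
      (card {i \<in> R. \<phi> i = j})) m = 0" for \<phi>
  proof (cases "card {i \<in> R. \<phi> i = j} = m")
    case True
    have "\<not> {i \<in> R. \<phi> i = j} \<subseteq> {i \<in> R. w i j \<noteq> 0}"
    proof
      assume "{i \<in> R. \<phi> i = j} \<subseteq> {i \<in> R. w i j \<noteq> 0}"
      from card_mono[OF _ this] assms m True show False by simp
    qed
    then obtain i where "i \<in> R" "w i (\<phi> i) = 0" by auto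
    hence "(\<Prod>i\<in>R. of_real (w i (\<phi> i)) * (if \<phi> i = j then 1 else x (\<phi> i))) = 0"
      using assms(1) by (intro prod_zero) auto
    thus ?thesis by (simp only: monom_eq_0 coeff_0)
  qed simp
  thus "coeff (\<Sum>\<phi>\<in>assignments R C S. monom (\<Prod>i\<in>R. of_real (w i (\<phi> i)) *
      (if \<phi> i = j then 1 else x (\<phi> i))) (card {i \<in> R. \<phi> i = j})) m = 0"
    by (simp only: coeff_sum sum.neutral_const)
qed

lemma trunc_prod_of_real:
  "trunc_prod R C w S (\<lambda>j. of_real (x j)) = of_real (trunc_prod R C w S x)"
  by (simp add: trunc_prod_def)

lemma map_poly_trunc_prod_poly:
  "map_poly of_real (trunc_prod_poly R C w S j x) = trunc_prod_poly R C w S j (\<lambda>j. of_real (x j))"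
  by (intro poly_eqI)
     (auto simp: coeff_map_poly trunc_prod_poly_def coeff_sum coeff_monom intro!: sum.cong prod.cong)

lemma trunc_prod_empty:
  assumes "finite R" "finite C"
  shows "trunc_prod R C w {} x = (\<Prod>i\<in>R. \<Sum>j\<in>C. of_real (w i j) * x j)"
  using assms by (simp add: trunc_prod_def assignments_def prod_sum_PiE)

lemma trunc_prod_nonneg:
  fixes x :: "'c \<Rightarrow> real"
  assumes "\<And>i j. i \<in> R \<Longrightarrow> j \<in> C \<Longrightarrow> w i j \<ge> 0" "\<And>j. j \<in> C \<Longrightarrow> x j \<ge> 0"
  shows "trunc_prod R C w S x \<ge> 0"
  unfolding trunc_prod_def assignments_def using assms
  by (auto intro!: sum_nonneg prod_nonneg mult_nonneg_nonneg simp: PiE_iff)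

text \<open>The slack variable \<open>z\<close> has positive weight in every row. Keeping it
  strictly inside a half-plane makes every row form nonzero even when the other variables lie on the
  boundary or vanish.\<close>

locale weighted_rows =
  fixes R :: "'r set" and C :: "'c set" and w :: "'r \<Rightarrow> 'c \<Rightarrow> real" and z :: 'c
  assumes finite_R: "finite R" and finite_C: "finite C" and z: "z \<in> C"
    and w_nonneg: "\<And>i j. i \<in> R \<Longrightarrow> j \<in> C \<Longrightarrow> w i j \<ge> 0"
    and w_z: "\<And>i. i \<in> R \<Longrightarrow> w i z > 0"
begin

text \<open>Stability is needed for every half-plane through the origin, that is for every \<open>u\<close>: this is what
  makes the one-variable restrictions at positive points real-rooted.\<close>

lemma trunc_prod_stable:
  fixes x :: "'c \<Rightarrow> complex" and u :: complex
  assumes "finite S" "z \<notin> S" "Re (u * x z) > 0" "\<And>j. j \<in> C \<Longrightarrow> Re (u * x j) \<ge> 0" "S \<subseteq> C"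
  shows "trunc_prod R C w S x \<noteq> 0"
  using assms
proof (induction S arbitrary: x rule: finite_induct)
  case empty
  have "(\<Sum>j\<in>C. of_real (w i j) * x j) \<noteq> 0" if i: "i \<in> R" for i
  proof -
    have "Re (u * (\<Sum>j\<in>C. of_real (w i j) * x j)) = (\<Sum>j\<in>C. w i j * Re (u * x j))"
      unfolding sum_distrib_left Re_sum by (intro sum.cong) (auto simp: algebra_simps)
    also have "\<dots> > 0" using i z w_z[OF i] w_nonneg[OF i] empty
      by (intro sum_pos2[OF finite_C z]) (auto simp del: times_complex.sel)
    finally show ?thesis by (metis less_irrefl mult_zero_right zero_complex.simps(1))
  qed
  thus ?case using finite_R by (simp add: trunc_prod_empty finite_C)
next
  case (insert j S)
  \<comment> \<open>Since \<open>j\<close> differs from \<open>z\<close>, replacing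
    \<open>x j\<close> by any \<open>s\<close> in the closed half-plane preserves the induction
    hypothesis' assumptions.\<close>
  have "poly (trunc_prod_poly R C w S j x) s \<noteq> 0" if "Re (u * s) \<ge> 0" for s
    unfolding poly_trunc_prod_poly[OF finite_R]
    using insert.prems that by (intro insert.IH) auto
  from truncation_stable[OF this, of u "x j"] insert.prems
  have "trunc_prod R C w (insert j S) (x(j := x j)) \<noteq> 0"
    unfolding trunc_prod_insert[OF finite_R finite_C] by blast
  thus ?case by simp
qed

text \<open>A number off the nonpositive real axis shares an open half-plane through the origin with
  the positive reals, so stability rules it out as a zero.\<close>

lemma trunc_prod_poly_roots:
  fixes x :: "'c \<Rightarrow> real"
  assumes "finite S" "S \<subseteq> C" "z \<notin> S" "j \<noteq> z" and x: "\<And>j. j \<in> C \<Longrightarrow> x j > 0"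
    and root: "poly (map_poly complex_of_real (trunc_prod_poly R C w S j x)) s = 0"
  shows "Im s = 0 \<and> Re s \<le> 0"
proof (rule ccontr)
  assume s: "\<not> (Im s = 0 \<and> Re s \<le> 0)"
  \<comment> \<open>Rotating by \<open>cnj q\<close> moves both \<open>s = q * q\<close> and the positive reals into the right half-plane.\<close>
  define q where "q = csqrt s"
  have q2: "q * q = s" by (simp add: q_def flip: power2_eq_square)
  have q: "Re q > 0"
  proof (rule ccontr)
    assume "\<not> Re q > 0"
    hence "Re q = 0" using Re_csqrt[of s] by (simp add: q_def)
    hence "Im (q * q) = 0 \<and> Re (q * q) \<le> 0" by simp
    thus False using s q2 by simp
  qed
  have "trunc_prod R C w S ((\<lambda>j. complex_of_real (x j))(j := s)) \<noteq> 0"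
  proof (rule trunc_prod_stable[where u = "cnj q"])
    have "cnj q * s = of_real ((cmod q)\<^sup>2) * q"
      unfolding q2[symmetric] complex_norm_square by (simp add: mult_ac)
    hence "Re (cnj q * s) \<ge> 0" using q by simp
    thus "Re (cnj q * ((\<lambda>j. complex_of_real (x j))(j := s)) i) \<ge> 0" if "i \<in> C" for i
      using q x[OF that] by simp
    show "Re (cnj q * ((\<lambda>j. complex_of_real (x j))(j := s)) z) > 0"
      using \<open>j \<noteq> z\<close> q x[OF z] by simp
  qed (use assms in auto)
  thus False using root
    by (simp add: map_poly_trunc_prod_poly poly_trunc_prod_poly finite_R)
qed

lemma trunc_prod_pos:
  fixes x :: "'c \<Rightarrow> real"
  assumes "finite S" "S \<subseteq> C" "z \<notin> S" "x z > 0" "\<And>j. j \<in> C \<Longrightarrow> x j \<ge> 0"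
  shows "trunc_prod R C w S x > 0"
proof -
  have "trunc_prod R C w S (\<lambda>j. complex_of_real (x j)) \<noteq> 0"
    using assms by (intro trunc_prod_stable[where u = 1]) auto
  moreover have "trunc_prod R C w S x \<ge> 0"
    using assms w_nonneg by (intro trunc_prod_nonneg) auto
  ultimately show ?thesis by (simp add: trunc_prod_of_real)
qed

text \<open>Induction over the truncated variables: with the other variables fixed, the bound so far
  is a growth bound in \<open>x j\<close>, and each truncation costs one factor
  \<open>cap_loss\<close>.\<close>

lemma trunc_prod_capacity:
  fixes x :: "'c \<Rightarrow> real" and \<alpha> :: "'c \<Rightarrow> real" and N :: "'c \<Rightarrow> nat"
  assumes "finite S" "S \<subseteq> C" "z \<notin> S" "K > 0"
    and \<alpha>: "\<And>j. j \<in> C - {z} \<Longrightarrow> 0 < \<alpha> j \<and> \<alpha> j \<le> 1"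
    and N: "\<And>j. j \<in> C - {z} \<Longrightarrow> N j \<ge> 1 \<and> card {i \<in> R. w i j \<noteq> 0} \<le> N j"
    and base: "\<And>x. (\<And>j. j \<in> C \<Longrightarrow> x j > 0) \<Longrightarrow>
      (\<Prod>i\<in>R. \<Sum>j\<in>C. w i j * x j) \<ge> K * (\<Prod>j\<in>C - {z}. x j powr \<alpha> j)"
    and x: "\<And>j. j \<in> C \<Longrightarrow> x j > 0"
  shows "trunc_prod R C w S x \<ge> (\<Prod>j\<in>S. cap_loss (\<alpha> j) (N j)) * (K * (\<Prod>j\<in>C - {z}. x j powr \<alpha> j))"
  using assms(1-3) x
proof (induction S arbitrary: x rule: finite_induct)
  case empty
  thus ?case using base by (simp add: trunc_prod_empty finite_R finite_C)
next
  case (insert j S)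
  let ?P = "trunc_prod_poly R C w S j x"
  let ?L = "\<Prod>j\<in>S. cap_loss (\<alpha> j) (N j)"
  let ?X = "\<Prod>j\<in>C - {z} - {j}. x j powr \<alpha> j"
  have j: "j \<in> C - {z}" using insert.prems by auto
  have X: "(\<Prod>i\<in>C - {z}. (x(j := t)) i powr \<alpha> i) = t powr \<alpha> j * ?X" for t
  proof -
    have "(\<Prod>i\<in>C - {z}. (x(j := t)) i powr \<alpha> i)
        = t powr \<alpha> j * (\<Prod>i\<in>C - {z} - {j}. (x(j := t)) i powr \<alpha> i)"
      using j finite_C by (subst prod.remove[of _ j]) auto
    also have "(\<Prod>i\<in>C - {z} - {j}. (x(j := t)) i powr \<alpha> i) = ?X"
      by (intro prod.cong) auto
    finally show ?thesis .
  qed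
  have Lpos: "?L > 0" using \<alpha> N insert.prems
    by (intro prod_pos cap_loss_pos) blast+
  have "x i powr \<alpha> i > 0" if "i \<in> C - {z} - {j}" for i
    using insert.prems(3)[of i] that by simp
  hence Xpos: "?X > 0" by (intro prod_pos)
  have "cap_loss (\<alpha> j) (N j) * (?L * K * ?X) * x j powr \<alpha> j \<le> coeff ?P 0 + coeff ?P 1 * x j"
  proof (rule truncation_capacity)
    \<comment> \<open>Positivity needs strictness only at \<open>z\<close>, so
      \<open>x j = 0\<close> is admissible and gives the constant term.\<close>
    have "trunc_prod R C w S (x(j := 0)) > 0"
      using insert.prems insert.hyps z by (intro trunc_prod_pos) (auto intro: less_imp_le)
    thus "poly ?P 0 > 0" by (simp add: poly_trunc_prod_poly finite_R)
    show "degree ?P \<le> N j" using N[OF j] by (intro degree_trunc_prod_poly_le finite_R) auto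
    show "Im s = 0 \<and> Re s \<le> 0" if "poly (map_poly complex_of_real ?P) s = 0" for s
      using that insert.prems insert.hyps by (intro trunc_prod_poly_roots[of S j x s]) auto
    show "?L * K * ?X * t powr \<alpha> j \<le> poly ?P t" if "t > 0" for t
    proof -
      have "?L * (K * (\<Prod>i\<in>C - {z}. (x(j := t)) i powr \<alpha> i)) \<le> trunc_prod R C w S (x(j := t))"
        using insert.prems that by (intro insert.IH) auto
      thus ?thesis by (simp only: X poly_trunc_prod_poly[OF finite_R] mult_ac)
    qed
    show "?L * K * ?X > 0" using Lpos Xpos \<open>K > 0\<close> by simp
  qed (use \<alpha>[OF j] N[OF j] insert.prems j in auto)
  also have "\<dots> = trunc_prod R C w (insert j S) (x(j := x j))"
    by (rule trunc_prod_insert[OF finite_R finite_C, symmetric])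
  also have "x(j := x j) = x" by simp
  finally show ?case using insert.hyps X[of "x j"] by (simp add: mult_ac)
qed

end

section \<open>Elementary inequalities\<close>

text \<open>With \<open>s\<close> the weighted mean, ln y \<le> y - 1 is applied at y = X j / s, and
  the weighted right-hand sides add up to 0.\<close>

lemma weighted_am_gm:
  fixes X \<mu> :: "'i \<Rightarrow> real"
  assumes "finite J" "\<And>j. j \<in> J \<Longrightarrow> \<mu> j \<ge> 0" "sum \<mu> J = 1" and X: "\<And>j. j \<in> J \<Longrightarrow> X j > 0"
  shows "(\<Prod>j\<in>J. X j powr \<mu> j) \<le> (\<Sum>j\<in>J. \<mu> j * X j)"
proof -
  define s where "s = (\<Sum>j\<in>J. \<mu> j * X j)"
  have "s \<ge> 0" unfolding s_def using assms(2) X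
    by (intro sum_nonneg mult_nonneg_nonneg) (auto simp: less_imp_le)
  moreover have "s \<noteq> 0"
  proof
    assume "s = 0"
    moreover have "\<forall>j\<in>J. \<mu> j * X j \<ge> 0" using assms(2) X by (simp add: less_imp_le)
    ultimately have "\<forall>j\<in>J. \<mu> j * X j = 0"
      using sum_nonneg_eq_0_iff[of J "\<lambda>j. \<mu> j * X j"] assms(1) by (simp add: s_def)
    hence "\<forall>j\<in>J. \<mu> j = 0" using X by fastforce
    thus False using assms(3) by simp
  qed
  ultimately have s: "s > 0" by simp
  have "(\<Sum>j\<in>J. \<mu> j * ln (X j)) - ln s = (\<Sum>j\<in>J. \<mu> j * ln (X j / s))"
  proof -
    have "(\<Sum>j\<in>J. \<mu> j * ln (X j / s)) = (\<Sum>j\<in>J. \<mu> j * ln (X j) - \<mu> j * ln s)"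
    proof (intro sum.cong refl)
      fix j assume "j \<in> J"
      thus "\<mu> j * ln (X j / s) = \<mu> j * ln (X j) - \<mu> j * ln s"
        using X[of j] s by (simp add: ln_div algebra_simps)
    qed
    thus ?thesis using assms(3) by (simp add: sum_subtractf sum_distrib_right[symmetric])
  qed
  also have "\<dots> \<le> (\<Sum>j\<in>J. \<mu> j * (X j / s - 1))"
    using X s assms(2) by (intro sum_mono mult_left_mono ln_le_minus_one) auto
  also have "\<dots> = (\<Sum>j\<in>J. \<mu> j * X j) / s - 1"
    using assms(3) by (simp add: right_diff_distrib sum_subtractf sum_divide_distrib)
  also have "\<dots> = 0" using s by (simp add: s_def)
  finally have "exp (\<Sum>j\<in>J. \<mu> j * ln (X j)) \<le> s" using s by (simp add: ln_ge_iff)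
  moreover have "exp (\<Sum>j\<in>J. \<mu> j * ln (X j)) = (\<Prod>j\<in>J. X j powr \<mu> j)"
    unfolding exp_sum[OF assms(1)] using X by (intro prod.cong) (force simp: powr_def)+
  ultimately show ?thesis by (simp add: s_def)
qed

lemma sum_if_lessThan:
  "(\<Sum>j<n + d. if j < n then f j else g j) = (\<Sum>j<n. f j) + (\<Sum>j=n..<n + d. g (j::nat))"
proof -
  have eq: "{..<n + d} = {..<n} \<union> {n..<n + d}" by auto
  show ?thesis unfolding eq
    by (subst sum.union_disjoint) (auto intro!: arg_cong2[of _ _ _ _ "(+)"] sum.cong)
qed

lemma prod_if_lessThan:
  "(\<Prod>j<n + d. if j < n then f j else g j) = (\<Prod>j<n. f j) * (\<Prod>j=n..<n + d. g (j::nat))"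
proof -
  have eq: "{..<n + d} = {..<n} \<union> {n..<n + d}" by auto
  show ?thesis unfolding eq
    by (subst prod.union_disjoint) (auto intro!: arg_cong2[of _ _ _ _ "(*)"] prod.cong)
qed

text \<open>The \<open>j\<close>-th power of the ratio of consecutive bases is (1 - 1/(j+1)^2)^j,
  which Bernoulli's inequality bounds below by (j+1)/(j+2).\<close>

lemma div_Suc_power_antimono:
  "(real (Suc j) / real (Suc (Suc j))) ^ Suc j \<le> (real j / real (Suc j)) ^ j"
proof -
  define a where "a = real j"
  have a: "a \<ge> 0" by (simp add: a_def)
  have "1 + real j * (- 1 / (a + 1)\<^sup>2) \<le> (1 + (- 1 / (a + 1)\<^sup>2)) ^ j"
    using a by (intro Bernoulli_inequality) (simp add: field_simps)
  moreover have "1 + (- 1 / (a + 1)\<^sup>2) = (a / (a + 1)) * ((a + 2) / (a + 1))"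
    using a by (simp add: divide_simps power2_eq_square) (simp add: algebra_simps)
  moreover have "(a + 1) / (a + 2) \<le> 1 + real j * (- 1 / (a + 1)\<^sup>2)"
    using a by (simp add: divide_simps a_def[symmetric] power2_eq_square) (simp add: algebra_simps)
  ultimately have "(a + 1) / (a + 2) \<le> (a / (a + 1)) ^ j * ((a + 2) / (a + 1)) ^ j"
    by (simp only: power_mult_distrib)
  hence "(a + 1) / (a + 2) * ((a + 1) / (a + 2)) ^ j
      \<le> (a / (a + 1)) ^ j * ((a + 2) / (a + 1)) ^ j * ((a + 1) / (a + 2)) ^ j"
    using a by (intro mult_right_mono) auto
  also have "\<dots> = (a / (a + 1)) ^ j * (((a + 2) / (a + 1)) * ((a + 1) / (a + 2))) ^ j"
    by (simp only: power_mult_distrib mult.assoc)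
  also have "((a + 2) / (a + 1)) * ((a + 1) / (a + 2)) = 1" using a by simp
  finally show ?thesis by (simp add: a_def add.commute)
qed

lemma fact_ge_power:
  assumes "d \<le> n"
  shows "((1 - 1 / real n) ^ (n - 1)) ^ d * real d ^ d \<le> fact d"
  using assms
proof (induction d)
  case (Suc d)
  define g where "g = (1 - 1 / real n) ^ (n - 1)"
  have g0: "g \<ge> 0" unfolding g_def using Suc.prems by (intro zero_le_power) auto
  \<comment> \<open>\<open>g\<close> is the term of this sequence at index \<open>n - 1\<close>, and
    \<open>Suc d \<le> n\<close> puts \<open>d\<close> at or before that index.\<close>
  have "antimono (\<lambda>j. (real j / real (Suc j)) ^ j)"
    unfolding antimono_iff_le_Suc using div_Suc_power_antimono by blast
  moreover have "g = (real (n - 1) / real (Suc (n - 1))) ^ (n - 1)"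
    using Suc.prems by (simp add: g_def of_nat_diff field_simps)
  ultimately have "g \<le> (real d / real (Suc d)) ^ d"
    using Suc.prems by (auto dest!: antimonoD[of _ d "n - 1"])
  hence "g * real (Suc d) ^ d \<le> real d ^ d" by (simp add: power_divide field_simps)
  hence "g ^ d * (g * real (Suc d) ^ d) * real (Suc d) \<le> g ^ d * real d ^ d * real (Suc d)"
    using g0 by (intro mult_right_mono mult_left_mono) auto
  also have "\<dots> \<le> fact d * real (Suc d)"
    using Suc unfolding g_def by (intro mult_right_mono) auto
  finally show ?case by (simp add: g_def mult_ac)
qed simp

text \<open>Composing with the inverse of one fixed bijection embeds the set into the permutations
  of \<open>A\<close>.\<close>

lemma card_bij_betw_le_fact:
  assumes "finite A"
  shows "card {f \<in> A \<rightarrow>\<^sub>E B. bij_betw f A B} \<le> fact (card A)"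
proof (cases "{f \<in> A \<rightarrow>\<^sub>E B. bij_betw f A B} = {}")
  case False
  then obtain g where g: "bij_betw g A B" by blast
  define h where "h = inv_into A g"
  have h: "bij_betw h B A" unfolding h_def by (rule bij_betw_inv_into[OF g])
  define F where "F f = (\<lambda>x. if x \<in> A then h (f x) else x)" for f
  have "F f permutes A" if "bij_betw f A B" for f
  proof (rule bij_imp_permutes)
    have "bij_betw (h \<circ> f) A A" using that h by (rule bij_betw_trans)
    thus "bij_betw (F f) A A" by (rule bij_betw_cong[THEN iffD1, rotated]) (auto simp: F_def)
  qed (simp add: F_def)
  moreover have "inj_on F {f \<in> A \<rightarrow>\<^sub>E B. bij_betw f A B}"
  proof (rule inj_onI)
    fix f f' assume f: "f \<in> {f \<in> A \<rightarrow>\<^sub>E B. bij_betw f A B}" "f' \<in> {f \<in> A \<rightarrow>\<^sub>E B. bij_betw f A B}"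
      and eq: "F f = F f'"
    have "f x = f' x" if x: "x \<in> A" for x
    proof (rule inj_onD[OF bij_betw_imp_inj_on[OF h]])
      show "h (f x) = h (f' x)" using fun_cong[OF eq, of x] x by (simp add: F_def)
    qed (use f x in auto)
    thus "f = f'" using f by (intro PiE_ext[of f A "\<lambda>_. B" f']) auto
  qed
  ultimately have "card {f \<in> A \<rightarrow>\<^sub>E B. bij_betw f A B} \<le> card {\<pi>. \<pi> permutes A}"
    using assms by (intro card_inj_on_le[where f = F]) (auto simp: finite_permutations)
  thus ?thesis using assms by (simp add: card_permutations)
next
  case True
  show ?thesis unfolding True by simp
qed

section \<open>Assignments and partial permanents\<close>

text \<open>Weighted AM-GM in each row. The weights \<open>\<mu>\<close> sum to 1 along rows, to
  \<open>p\<close> down a column of \<open>A\<close> and to 1 down a dummy column, so multiplying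
  the rows yields exactly these exponents.\<close>

lemma prod_row_sums_ge:
  fixes A :: "nat \<Rightarrow> nat \<Rightarrow> nat" and x :: "nat \<Rightarrow> real"
  assumes A: "in_Lambda k n A" and "k \<ge> 1" "1 \<le> m" "m + d = n"
    and x: "\<And>j. j \<le> n + d \<Longrightarrow> x j > 0"
  defines "p \<equiv> real m / real n"
  shows "(\<Prod>i<n. \<Sum>j\<le>n + d. (if j < n then real (A i j) else 1) * x j)
    \<ge> (real k / p) ^ m * real n ^ d * (\<Prod>j<n + d. x j powr (if j < n then p else 1))"
proof -
  define \<mu> where "\<mu> i j = (if j < n then real (A i j) * p / real k else 1 / real n)" for i j
  \<comment> \<open>Rescaled so that \<open>\<mu> i j * X j\<close> is the original term of the row
    sum.\<close>
  define X where "X j = (if j < n then real k * x j / p else real n * x j)" for j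
  have n: "n > 0" and p: "p > 0" using assms by (auto simp: p_def)
  have pn: "p * real n = real m" using n by (simp add: p_def)
  have X: "X j > 0" if "j < n + d" for j using x[of j] that p n assms(2) by (auto simp: X_def)
  have row: "(\<Sum>j<n. real (A i j)) = real k" and col: "(\<Sum>j<n. real (A j i)) = real k" if "i < n" for i
    using A that by (auto simp: in_Lambda_def simp flip: of_nat_sum)
  have mu_row: "(\<Sum>j<n + d. \<mu> i j) = 1" if i: "i < n" for i
  proof -
    have "(\<Sum>j<n + d. \<mu> i j) = (\<Sum>j<n. real (A i j)) * p / real k + real d / real n"
      unfolding \<mu>_def sum_if_lessThan by (simp add: sum_divide_distrib sum_distrib_right)
    also have "\<dots> = p + real d / real n" using row[OF i] assms(2) by simp
    also have "\<dots> = 1" using n \<open>m + d = n\<close> by (auto simp: p_def field_simps)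
    finally show ?thesis .
  qed
  have mu_col: "(\<Sum>i<n. \<mu> i j) = (if j < n then p else 1)" for j
  proof (cases "j < n")
    case True
    have "(\<Sum>i<n. \<mu> i j) = (\<Sum>i<n. real (A i j)) * p / real k"
      using True by (simp add: \<mu>_def sum_divide_distrib sum_distrib_right)
    thus ?thesis using col[OF True] True assms(2) by simp
  qed (use n in \<open>simp add: \<mu>_def\<close>)
  have row_ge: "(\<Prod>j<n + d. X j powr \<mu> i j) \<le> (\<Sum>j\<le>n + d. (if j < n then real (A i j) else 1) * x j)"
    if i: "i < n" for i
  proof -
    have "(\<Prod>j<n + d. X j powr \<mu> i j) \<le> (\<Sum>j<n + d. \<mu> i j * X j)"
      using mu_row[OF i] X p by (intro weighted_am_gm) (auto simp: \<mu>_def)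
    also have "\<dots> = (\<Sum>j<n + d. (if j < n then real (A i j) else 1) * x j)"
      using p n assms(2) by (intro sum.cong) (auto simp: \<mu>_def X_def)
    \<comment> \<open>The slack column carries no weight in AM-GM; its positive term is added only
      here.\<close>
    also have "\<dots> \<le> (\<Sum>j\<le>n + d. (if j < n then real (A i j) else 1) * x j)"
      using x by (intro sum_mono2) (auto intro!: mult_nonneg_nonneg simp: less_imp_le)
    finally show ?thesis .
  qed
  have "(\<Prod>j<n + d. X j powr (if j < n then p else 1)) = (\<Prod>j<n + d. \<Prod>i<n. X j powr \<mu> i j)"
    unfolding mu_col[symmetric] using X
    by (intro prod.cong refl powr_sum) (auto simp: less_imp_neq[symmetric])
  also have "\<dots> = (\<Prod>i<n. \<Prod>j<n + d. X j powr \<mu> i j)" by (rule prod.swap)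
  also have "\<dots> \<le> (\<Prod>i<n. \<Sum>j\<le>n + d. (if j < n then real (A i j) else 1) * x j)"
    using row_ge by (intro prod_mono conjI prod_nonneg) auto
  finally have "(\<Prod>j<n + d. X j powr (if j < n then p else 1))
      \<le> (\<Prod>i<n. \<Sum>j\<le>n + d. (if j < n then real (A i j) else 1) * x j)" .
  moreover have "(\<Prod>j<n + d. X j powr (if j < n then p else 1))
      = (\<Prod>j<n + d. (if j < n then (real k / p) powr p else real n) * x j powr (if j < n then p else 1))"
    using x p n by (intro prod.cong) (auto simp: X_def powr_mult[symmetric] abs_mult)
  moreover have "\<dots> = (real k / p) ^ m * real n ^ d * (\<Prod>j<n + d. x j powr (if j < n then p else 1))"
  proof -
    have "((real k / p) powr p) ^ n = (real k / p) powr (p * real n)"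
      using p assms(2) by (simp add: powr_powr flip: powr_realpow)
    also have "\<dots> = (real k / p) ^ m" unfolding pn using p assms(2) by (simp add: powr_realpow)
    finally show ?thesis by (simp add: prod.distrib prod_if_lessThan)
  qed
  ultimately show ?thesis by simp
qed

text \<open>Such an assignment splits into a bijection from an \<open>m\<close>-set of rows to an
  \<open>m\<close>-set of columns of \<open>A\<close>, and a bijection from the other
  \<open>d\<close> rows to the dummies. The latter has weight 1 and at most \<open>d!\<close>
  choices.\<close>

lemma sum_saturating_assignments_le:
  fixes A :: "nat \<Rightarrow> nat \<Rightarrow> nat"
  assumes "m + d = n"
    and G: "\<And>\<phi>. \<phi> \<in> G \<Longrightarrow> \<phi> \<in> {..<n} \<rightarrow>\<^sub>E {..<n + d} \<and> inj_on \<phi> {..<n} \<and> card {i \<in> {..<n}. \<not> \<phi> i < n} = d"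
    and fin: "finite G"
  shows "(\<Sum>\<phi>\<in>G. \<Prod>i<n. if \<phi> i < n then real (A i (\<phi> i)) else 1) \<le> fact d * real (Per_m n m A)"
proof -
  define Sub where "Sub = {I. I \<subseteq> {0..<n} \<and> card I = m}"
  define Bij where "Bij I J = {\<sigma> \<in> I \<rightarrow>\<^sub>E J. bij_betw \<sigma> I J}" for I J :: "nat set"
  define Y where "Y = {n..<n + d}"
  define T where "T = (SIGMA I:Sub. SIGMA J:Sub. Bij I J \<times> Bij ({..<n} - I) Y)"
  define val :: "nat set \<times> nat set \<times> (nat \<Rightarrow> nat) \<times> (nat \<Rightarrow> nat) \<Rightarrow> real"
    where "val = (\<lambda>(I, J, \<sigma>, \<tau>). \<Prod>i\<in>I. real (A i (\<sigma> i)))"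
  define glue :: "nat set \<times> nat set \<times> (nat \<Rightarrow> nat) \<times> (nat \<Rightarrow> nat) \<Rightarrow> nat \<Rightarrow> nat"
    where "glue = (\<lambda>(I, J, \<sigma>, \<tau>). restrict (\<lambda>i. if i \<in> I then \<sigma> i else \<tau> i) {..<n})"
  have finSub: "finite Sub" unfolding Sub_def by (rule finite_subset[of _ "Pow {0..<n}"]) auto
  have finI: "finite I" if "I \<in> Sub" for I using that by (auto simp: Sub_def intro: finite_subset)
  have finBij: "finite (Bij I J)" if "finite I" "finite J" for I J
    unfolding Bij_def using that by (intro finite_subset[OF _ finite_PiE[of I "\<lambda>_. J"]]) auto
  have finT: "finite T" unfolding T_def Y_def
    using finSub finI finBij by (intro finite_SigmaI finite_cartesian_product) auto
  have "(\<Sum>\<phi>\<in>G. \<Prod>i<n. if \<phi> i < n then real (A i (\<phi> i)) else 1) \<le> sum val T"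
  proof (rule sum_le_included[where i = glue])
    show "\<forall>\<phi>\<in>G. \<exists>t\<in>T. glue t = \<phi> \<and> (\<Prod>i<n. if \<phi> i < n then real (A i (\<phi> i)) else 1) \<le> val t"
    proof
      fix \<phi> assume "\<phi> \<in> G"
      from G[OF this] have ext: "\<phi> \<in> {..<n} \<rightarrow>\<^sub>E {..<n + d}" and inj: "inj_on \<phi> {..<n}"
        and card: "card {i \<in> {..<n}. \<not> \<phi> i < n} = d" by auto
      define I where "I = {i \<in> {..<n}. \<phi> i < n}"
      have I: "I \<subseteq> {..<n}" by (auto simp: I_def)
      have cI: "{..<n} - I = {i \<in> {..<n}. \<not> \<phi> i < n}" by (auto simp: I_def)
      have "card ({..<n} - I) = n - card I"
        using I by (subst card_Diff_subset) (auto intro: finite_subset)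
      moreover have "card I \<le> n" using I card_mono[of "{..<n}" I] by simp
      ultimately have "card I = m" using card assms(1) unfolding cI by simp
      hence I_Sub: "I \<in> Sub" using I by (auto simp: Sub_def)
      have injI: "inj_on \<phi> I" and injcI: "inj_on \<phi> ({..<n} - I)"
        using inj I by (auto intro: inj_on_subset)
      have J_Sub: "\<phi> ` I \<in> Sub"
        using card_image[OF injI] \<open>card I = m\<close> by (auto simp: Sub_def I_def)
      \<comment> \<open>An injection of \<open>d\<close> rows into \<open>d\<close> dummies is
        onto.\<close>
      have "\<phi> ` ({..<n} - I) = Y"
      proof (rule card_subset_eq)
        show "\<phi> ` ({..<n} - I) \<subseteq> Y" using ext unfolding cI Y_def PiE_iff by fastforce
        show "card (\<phi> ` ({..<n} - I)) = card Y" using card_image[OF injcI] card cI by (simp add: Y_def)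
      qed (simp add: Y_def)
      hence \<tau>: "restrict \<phi> ({..<n} - I) \<in> Bij ({..<n} - I) Y"
        using injcI by (auto simp: Bij_def bij_betw_def inj_on_restrict_eq)
      have \<sigma>: "restrict \<phi> I \<in> Bij I (\<phi> ` I)"
        using injI by (auto simp: Bij_def bij_betw_def inj_on_restrict_eq)
      let ?t = "(I, \<phi> ` I, restrict \<phi> I, restrict \<phi> ({..<n} - I))"
      have "?t \<in> T" using I_Sub J_Sub \<sigma> \<tau> by (simp add: T_def)
      moreover have "glue ?t = \<phi>"
        using ext by (auto simp: glue_def fun_eq_iff PiE_iff extensional_def)
      moreover have "(\<Prod>i<n. if \<phi> i < n then real (A i (\<phi> i)) else 1) = val ?t"
        unfolding val_def by (simp add: prod.inter_filter[symmetric] I_def)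
      ultimately show "\<exists>t\<in>T. glue t = \<phi> \<and> (\<Prod>i<n. if \<phi> i < n then real (A i (\<phi> i)) else 1) \<le> val t"
        by (metis order_refl)
    qed
  qed (use fin finT in \<open>auto simp: val_def intro!: prod_nonneg\<close>)
  also have "sum val T = (\<Sum>I\<in>Sub. \<Sum>J\<in>Sub. \<Sum>\<sigma>\<in>Bij I J. \<Sum>\<tau>\<in>Bij ({..<n} - I) Y. \<Prod>i\<in>I. real (A i (\<sigma> i)))"
    unfolding T_def val_def Y_def using finSub finI finBij
    by (simp add: sum.Sigma sum.cartesian_product finite_cartesian_product split_def del: sum_constant)
  also have "\<dots> = (\<Sum>I\<in>Sub. \<Sum>J\<in>Sub. real (card (Bij ({..<n} - I) Y)) * real (per_sub A I J))"
    by (simp add: per_sub_def Bij_def sum_distrib_left)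
  also have "\<dots> \<le> (\<Sum>I\<in>Sub. \<Sum>J\<in>Sub. fact d * real (per_sub A I J))"
  proof (intro sum_mono mult_right_mono)
    fix I assume I: "I \<in> Sub"
    have "card ({..<n} - I) = d"
      using I finI[OF I] assms(1) by (subst card_Diff_subset) (auto simp: Sub_def)
    hence "card (Bij ({..<n} - I) Y) \<le> fact d"
      unfolding Bij_def using card_bij_betw_le_fact[of "{..<n} - I" Y] by simp
    thus "real (card (Bij ({..<n} - I) Y)) \<le> fact d" by (metis of_nat_fact of_nat_le_iff)
  qed simp
  also have "\<dots> = fact d * real (Per_m n m A)"
    by (simp add: Per_m_def Sub_def sum_distrib_left)
  finally show ?thesis .
qed

lemma Per_m_ge_cap_loss:
  fixes k n m d :: nat and A :: "nat \<Rightarrow> nat \<Rightarrow> nat"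
  assumes k: "k \<ge> 1" and A: "in_Lambda k n A" and m: "1 \<le> m" and nd: "m + d = n"
  defines "p \<equiv> real m / real n"
  shows "cap_loss p k ^ n * cap_loss 1 n ^ d * ((real k / p) ^ m * real n ^ d)
    \<le> fact d * real (Per_m n m A)"
proof -
  \<comment> \<open>Columns \<open>n, \<dots>, n + d - 1\<close> are dummies absorbing the rows left unmatched. Column \<open>n + d\<close>
    is never truncated; it only keeps all polynomials nonzero and is sent to 0 at the end.\<close>
  define w where "w i j = (if j < n then real (A i j) else 1)" for i j
  define \<alpha> where "\<alpha> j = (if j < n then p else 1)" for j :: nat
  define N where "N j = (if j < n then k else n)" for j :: nat
  define K where "K = (real k / p) ^ m * real n ^ d"
  have n: "n > 0" and p: "p > 0" "p \<le> 1" using m nd by (auto simp: p_def)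
  interpret weighted_rows "{..<n}" "{..n + d}" w "n + d"
    by unfold_locales (auto simp: w_def)
  have C: "{..n + d} - {n + d} = {..<n + d}" by auto
  define L where "L = cap_loss p k ^ n * cap_loss 1 n ^ d * K"
  define \<Phi> where "\<Phi> = assignments {..<n} {..n + d} {..<n + d}"
  \<comment> \<open>These avoid the slack column and use all \<open>d\<close> dummies, leaving
    exactly \<open>m\<close> rows for columns of \<open>A\<close>.\<close>
  define Good where "Good = {\<phi> \<in> \<Phi>. (\<forall>i<n. \<phi> i \<noteq> n + d) \<and> card {i \<in> {..<n}. n \<le> \<phi> i \<and> \<phi> i < n + d} = d}"
  define wt where "wt \<phi> = (\<Prod>i<n. w i (\<phi> i))" for \<phi>
  have fin: "finite \<Phi>" unfolding \<Phi>_def by (intro finite_assignments) auto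
  have wt0: "wt \<phi> \<ge> 0" for \<phi> unfolding wt_def w_def by (intro prod_nonneg) auto
  have support: "card {i \<in> {..<n}. w i j \<noteq> 0} \<le> N j" for j
  proof (cases "j < n")
    case True
    \<comment> \<open>Nonzero entries are integers at least 1, so a column with sum \<open>k\<close>
      has at most \<open>k\<close> of them.\<close>
    have "card {i \<in> {..<n}. w i j \<noteq> 0} = (\<Sum>i\<in>{i \<in> {..<n}. w i j \<noteq> 0}. 1)" by simp
    also have "\<dots> \<le> (\<Sum>i\<in>{i \<in> {..<n}. w i j \<noteq> 0}. A i j)"
      using True by (intro sum_mono) (auto simp: w_def)
    also have "\<dots> \<le> (\<Sum>i<n. A i j)" by (intro sum_mono2) auto
    also have "\<dots> = k" using A True by (simp add: in_Lambda_def)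
    finally show ?thesis using True by (simp add: N_def)
  next
    case False
    have "card {i \<in> {..<n}. w i j \<noteq> 0} \<le> card {..<n}" by (intro card_mono) auto
    thus ?thesis using False by (simp add: N_def)
  qed
  have Kpos: "K > 0" using k p n by (simp add: K_def)
  \<comment> \<open>Evaluate at 1 on the columns of \<open>A\<close>, at \<open>t\<close> on the dummies and at \<open>1 / t\<close> on the last
    column: as \<open>t\<close> grows, only the assignments in \<open>Good\<close> contribute at order \<open>t ^ d\<close>.\<close>
  have bound: "L \<le> sum wt Good + sum wt \<Phi> / t" if t: "t \<ge> 1" for t :: real
  proof -
    define x where "x j = (if j < n then 1 else if j < n + d then t else 1 / t)" for j
    have x: "x j > 0" for j using t by (auto simp: x_def)
    have "(\<Prod>j<n + d. cap_loss (\<alpha> j) (N j)) * (K * (\<Prod>j\<in>{..n + d} - {n + d}. x j powr \<alpha> j))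
        \<le> trunc_prod {..<n} {..n + d} w {..<n + d} x"
    proof (rule trunc_prod_capacity)
      show "N j \<ge> 1 \<and> card {i \<in> {..<n}. w i j \<noteq> 0} \<le> N j" for j
        using support[of j] k n by (auto simp: N_def)
      show "K * (\<Prod>j\<in>{..n + d} - {n + d}. x j powr \<alpha> j) \<le> (\<Prod>i<n. \<Sum>j\<le>n + d. w i j * x j)"
        if "\<And>j. j \<in> {..n + d} \<Longrightarrow> x j > 0" for x
        unfolding C K_def \<alpha>_def w_def p_def using that k m nd A
        by (intro prod_row_sums_ge) auto
    qed (use p x Kpos in \<open>auto simp: \<alpha>_def\<close>)
    moreover have "(\<Prod>j<n + d. cap_loss (\<alpha> j) (N j)) = cap_loss p k ^ n * cap_loss 1 n ^ d"
    proof -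
      have "(\<Prod>j<n + d. cap_loss (\<alpha> j) (N j)) = (\<Prod>j<n + d. if j < n then cap_loss p k else cap_loss 1 n)"
        by (intro prod.cong) (auto simp: \<alpha>_def N_def)
      thus ?thesis by (simp add: prod_if_lessThan)
    qed
    moreover have "(\<Prod>j<n + d. x j powr \<alpha> j) = t ^ d"
    proof -
      have "(\<Prod>j<n + d. x j powr \<alpha> j) = (\<Prod>j<n + d. if j < n then 1 else t)"
        using t by (intro prod.cong) (auto simp: \<alpha>_def x_def)
      thus ?thesis by (simp add: prod_if_lessThan)
    qed
    ultimately have lower: "L * t ^ d \<le> trunc_prod {..<n} {..n + d} w {..<n + d} x"
      by (simp add: C L_def mult_ac)
    have monomial_le: "(\<Prod>i<n. x (\<phi> i)) \<le> t ^ d * ((if \<phi> \<in> Good then 1 else 0) + 1 / t)" if phi: "\<phi> \<in> \<Phi>" for \<phi>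
    proof -
      define a where "a = card {i \<in> {..<n}. n \<le> \<phi> i \<and> \<phi> i < n + d}"
      define b where "b = card {i \<in> {..<n}. \<phi> i = n + d}"
      have ext: "\<phi> \<in> {..<n} \<rightarrow>\<^sub>E {..n + d}" and le1: "\<And>j. j < n + d \<Longrightarrow> card {i \<in> {..<n}. \<phi> i = j} \<le> 1"
        using phi by (auto simp: \<Phi>_def assignments_def)
      have "(\<Prod>i<n. x (\<phi> i)) = (\<Prod>i<n. (if n \<le> \<phi> i \<and> \<phi> i < n + d then t else 1) * (if \<phi> i = n + d then 1 / t else 1))"
        using ext by (intro prod.cong) (auto simp: x_def PiE_iff le_less)
      also have "\<dots> = t ^ a * (1 / t) ^ b"
        unfolding prod.distrib a_def b_def by (simp add: prod.inter_filter[symmetric])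
      finally have eq: "(\<Prod>i<n. x (\<phi> i)) = t ^ a * (1 / t) ^ b" .
      have "a \<le> card {n..<n + d}" unfolding a_def
      proof (rule card_inj_on_le[where f = \<phi>])
        show "inj_on \<phi> {i \<in> {..<n}. n \<le> \<phi> i \<and> \<phi> i < n + d}"
        proof (rule inj_onI)
          fix i i' assume i: "i \<in> {i \<in> {..<n}. n \<le> \<phi> i \<and> \<phi> i < n + d}"
            "i' \<in> {i \<in> {..<n}. n \<le> \<phi> i \<and> \<phi> i < n + d}" "\<phi> i = \<phi> i'"
          hence "card {l \<in> {..<n}. \<phi> l = \<phi> i} \<le> Suc 0" using le1[of "\<phi> i"] by simp
          thus "i = i'" using i by (subst (asm) card_le_Suc0_iff_eq) auto
        qed
      qed auto
      hence ad: "a \<le> d" by simp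
      have one_b: "(1 / t) ^ b \<le> 1" using t by (intro power_le_one) auto
      show ?thesis
      proof (cases "\<phi> \<in> Good")
        case True
        have "t ^ a * (1 / t) ^ b \<le> t ^ d * 1"
          using ad t one_b by (intro mult_mono power_increasing) auto
        also have "\<dots> \<le> t ^ d * (1 + 1 / t)" using t by (intro mult_left_mono) auto
        finally show ?thesis using True eq by simp
      next
        case False
        \<comment> \<open>Outside \<open>Good\<close> a dummy is missed or the slack column is used;
          either costs a factor t.\<close>
        have "a < d \<or> b > 0"
        proof (rule ccontr)
          assume *: "\<not> (a < d \<or> b > 0)"
          hence "{i \<in> {..<n}. \<phi> i = n + d} = {}" by (simp add: b_def)
          hence "\<forall>i<n. \<phi> i \<noteq> n + d" by blast
          with * ad False phi show False by (auto simp: Good_def a_def)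
        qed
        hence "t ^ a * (1 / t) ^ b \<le> t ^ d * (1 / t)"
        proof
          assume "a < d"
          hence "t ^ Suc a \<le> t ^ d" using t by (intro power_increasing) auto
          hence "t ^ a \<le> t ^ d * (1 / t)" using t by (simp add: field_simps)
          hence "t ^ a * (1 / t) ^ b \<le> (t ^ d * (1 / t)) * 1"
            using one_b t by (intro mult_mono) auto
          thus ?thesis by simp
        next
          assume "b > 0"
          hence "(1 / t) ^ b \<le> (1 / t) ^ 1" using t by (intro power_decreasing) auto
          thus ?thesis using ad t by (intro mult_mono power_increasing) auto
        qed
        thus ?thesis using False eq by simp
      qed
    qed
    have "trunc_prod {..<n} {..n + d} w {..<n + d} x = (\<Sum>\<phi>\<in>\<Phi>. wt \<phi> * (\<Prod>i<n. x (\<phi> i)))"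
      by (simp add: trunc_prod_def \<Phi>_def wt_def prod.distrib)
    also have "\<dots> \<le> (\<Sum>\<phi>\<in>\<Phi>. wt \<phi> * (t ^ d * ((if \<phi> \<in> Good then 1 else 0) + 1 / t)))"
      using monomial_le wt0 by (intro sum_mono mult_left_mono) auto
    also have "\<dots> = (\<Sum>\<phi>\<in>\<Phi>. t ^ d * ((if \<phi> \<in> Good then wt \<phi> else 0) + wt \<phi> / t))"
      by (intro sum.cong) (auto simp: algebra_simps)
    also have "\<dots> = t ^ d * ((\<Sum>\<phi>\<in>\<Phi>. if \<phi> \<in> Good then wt \<phi> else 0) + sum wt \<Phi> / t)"
      by (simp add: sum_distrib_left sum.distrib sum_divide_distrib distrib_left)
    also have "(\<Sum>\<phi>\<in>\<Phi>. if \<phi> \<in> Good then wt \<phi> else 0) = sum wt Good"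
    proof -
      have "\<Phi> \<inter> Good = Good" by (auto simp: Good_def)
      thus ?thesis using sum.inter_restrict[OF fin, of wt Good] by simp
    qed
    finally have "L * t ^ d \<le> (sum wt Good + sum wt \<Phi> / t) * t ^ d"
      using lower by (simp add: mult_ac)
    thus ?thesis using t by simp
  qed
  have "L \<le> sum wt Good"
  proof (rule ccontr)
    assume "\<not> L \<le> sum wt Good"
    define e where "e = L - sum wt Good"
    have e: "e > 0" using \<open>\<not> L \<le> sum wt Good\<close> by (simp add: e_def)
    have D: "sum wt \<Phi> \<ge> 0" using wt0 by (intro sum_nonneg) auto
    \<comment> \<open>This \<open>t\<close> makes the error term \<open>sum wt \<Phi> / t\<close>
      smaller than the supposed gap \<open>e\<close>.\<close>
    have "e \<le> sum wt \<Phi> / (1 + sum wt \<Phi> / e)"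
      using bound[of "1 + sum wt \<Phi> / e"] D e by (simp add: e_def)
    moreover have "1 + sum wt \<Phi> / e > 0" using D e by (simp add: add_pos_nonneg)
    ultimately have "e * (1 + sum wt \<Phi> / e) \<le> sum wt \<Phi>" by (simp add: pos_le_divide_eq)
    thus False using e by (simp add: distrib_left)
  qed
  also have "sum wt Good = (\<Sum>\<phi>\<in>Good. \<Prod>i<n. if \<phi> i < n then real (A i (\<phi> i)) else 1)"
    by (simp add: wt_def w_def)
  also have "\<dots> \<le> fact d * real (Per_m n m A)"
  proof (rule sum_saturating_assignments_le[OF nd])
    show "finite Good" using fin by (simp add: Good_def)
    fix \<phi> assume "\<phi> \<in> Good"
    hence ext: "\<phi> \<in> {..<n} \<rightarrow>\<^sub>E {..n + d}" and nz: "\<And>i. i < n \<Longrightarrow> \<phi> i \<noteq> n + d"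
      and le1: "\<And>j. j < n + d \<Longrightarrow> card {i \<in> {..<n}. \<phi> i = j} \<le> 1"
      and cd: "card {i \<in> {..<n}. n \<le> \<phi> i \<and> \<phi> i < n + d} = d"
      by (auto simp: Good_def \<Phi>_def assignments_def)
    have lt: "\<phi> i < n + d" if "i < n" for i
      using ext nz[OF that] that by (auto simp: PiE_iff le_less)
    have "inj_on \<phi> {..<n}"
    proof (rule inj_onI)
      fix i i' assume i: "i \<in> {..<n}" "i' \<in> {..<n}" "\<phi> i = \<phi> i'"
      hence "card {l \<in> {..<n}. \<phi> l = \<phi> i} \<le> Suc 0" using le1[of "\<phi> i"] lt by simp
      thus "i = i'" using i by (subst (asm) card_le_Suc0_iff_eq) auto
    qed
    moreover have "{i \<in> {..<n}. n \<le> \<phi> i \<and> \<phi> i < n + d} = {i \<in> {..<n}. \<not> \<phi> i < n}"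
      using lt by auto
    ultimately show "\<phi> \<in> {..<n} \<rightarrow>\<^sub>E {..<n + d} \<and> inj_on \<phi> {..<n} \<and> card {i \<in> {..<n}. \<not> \<phi> i < n} = d"
      using ext lt cd by (simp add: PiE_iff)
  qed
  finally show ?thesis by (simp add: L_def K_def)
qed

section \<open>From the capacity bound to the stated constants\<close>

theorem theorem3p2:
  fixes k n m :: nat and A :: "nat \<Rightarrow> nat \<Rightarrow> nat"
  assumes "k \<ge> 1" and "n \<ge> 1"
    and "in_Lambda k n A"
    and "1 \<le> m" and "m \<le> n"
  defines "p \<equiv> real m / real n"
  shows "real (Per_m n m A) \<ge>
    (rpow ((real k - p) / real k) (real n * (real k - p))
       * rpow (1 - 1 / real n) (2 * (1 - 1 / real n) * real n * real (n - m)))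
    / ((p / real k) ^ m * real n powr (- 2 * real (n - m)) * (real (fact (n - m)))^2)"
proof -
  define d where "d = n - m"
  have nd: "m + d = n" using assms by (simp add: d_def)
  define g where "g = (1 - 1 / real n) ^ (n - 1)"
  define E where "E = rpow ((real k - p) / real k) (real n * (real k - p))"
  define h where "h = (real d / real n) ^ d"
  have n: "n > 0" and p: "p > 0" "p \<le> 1" using assms by (auto simp: p_def)
  have g: "g \<ge> 0" using n by (simp add: g_def)
  have E: "E \<ge> 0" by (simp add: E_def rpow_nonneg)
  have h: "h > 0" using n by (cases "d = 0") (auto simp: h_def)
  have q: "1 - p = real d / real n" using n nd by (auto simp: p_def field_simps)
  \<comment> \<open>Since n (1 - p) = d, the \<open>n\<close> denominators multiply to (d/n)^d,
    which is 1 for \<open>d = 0\<close> under both power conventions.\<close>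
  have loss_p: "cap_loss p k ^ n = E / h"
  proof -
    have "rpow ((real k - p) / real k) (real k - p) ^ n = E"
      unfolding E_def using p assms(1) n by (intro rpow_power) auto
    moreover have "rpow (1 - p) (1 - p) ^ n = rpow (1 - p) (real n * (1 - p))"
      using p n by (intro rpow_power) auto
    moreover have "real n * (1 - p) = real d" using n by (simp add: q)
    moreover have "rpow (1 - p) (real d) = h" unfolding h_def q by (intro rpow_of_nat) auto
    ultimately show ?thesis by (simp add: cap_loss_def power_divide)
  qed
  have loss_1: "cap_loss 1 n = g"
  proof -
    have "rpow ((real n - 1) / real n) (real (n - 1)) = ((real n - 1) / real n) ^ (n - 1)"
      using n by (intro rpow_of_nat) auto
    moreover have "(real n - 1) / real n = 1 - 1 / real n" using n by (simp add: field_simps)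
    ultimately show ?thesis using n by (simp add: cap_loss_def g_def rpow_def of_nat_diff)
  qed
  have g_rpow: "rpow (1 - 1 / real n) (2 * (1 - 1 / real n) * real n * real (n - m)) = (g ^ d)\<^sup>2"
  proof -
    \<comment> \<open>The exponent is an integer, so \<open>rpow\<close> becomes an ordinary power;
      for \<open>n = 1\<close> it is 0^0 = 1.\<close>
    have "2 * (1 - 1 / real n) * real n * real (n - m) = real ((n - 1) * d * 2)"
      using n by (simp add: d_def of_nat_diff field_simps)
    hence "rpow (1 - 1 / real n) (2 * (1 - 1 / real n) * real n * real (n - m))
        = (1 - 1 / real n) ^ ((n - 1) * d * 2)"
      using n by (simp only:) (intro rpow_of_nat, auto)
    thus ?thesis by (simp add: g_def power_mult)
  qed
  have n_powr: "real n powr (- 2 * real (n - m)) = 1 / (real n ^ d)\<^sup>2"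
  proof -
    have "real n powr (- 2 * real (n - m)) = 1 / real n powr (real (d * 2))"
      by (simp add: d_def powr_minus_divide mult.commute flip: powr_minus)
    thus ?thesis using n by (simp only: powr_realpow of_nat_0_less_iff power_mult)
  qed
  define c where "c = (real k / p) ^ m"
  have c: "c \<ge> 0" using p by (simp add: c_def)
  have pk: "(p / real k) ^ m = 1 / c" by (simp add: c_def power_divide)
  have "g ^ d * real d ^ d \<le> fact d"
    using fact_ge_power[of d n] nd by (simp add: g_def)
  hence key: "g ^ d * real n ^ d / fact d \<le> 1 / h"
    using n h by (simp add: h_def power_divide field_simps)
  \<comment> \<open>The claimed bound is split so that its last factor can be enlarged to
    \<open>1 / h\<close>, which turns it into the capacity bound.\<close>
  have "E * (g ^ d)\<^sup>2 / (1 / c * (1 / (real n ^ d)\<^sup>2) * (fact d)\<^sup>2)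
      = (E * g ^ d * c * real n ^ d / fact d) * (g ^ d * real n ^ d / fact d)"
    by (simp add: power2_eq_square)
  also have "\<dots> \<le> (E * g ^ d * c * real n ^ d / fact d) * (1 / h)"
    using key E g c by (intro mult_left_mono) auto
  also have "\<dots> = (cap_loss p k ^ n * cap_loss 1 n ^ d * (c * real n ^ d)) / fact d"
    by (simp add: loss_p loss_1 mult_ac)
  also have "\<dots> \<le> real (Per_m n m A)"
    using Per_m_ge_cap_loss[OF assms(1,3,4) nd] unfolding c_def p_def
    by (simp add: pos_divide_le_eq mult.commute)
  finally show ?thesis
    unfolding E_def[symmetric] g_rpow n_powr pk by (simp add: d_def)
qed

end
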